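(* Let $P$ and $Q$ be finite posets. Then the following hold: (a) Every $\mathfrak{p} \in \operatorname{Min}(L(P,Q))$ has height at least $|Q|$, and there exists a prime $\mathfrak{p} \in \operatorname{Min}(L(P,Q))$ with $\operatorname{height}(\mathfrak{p}) = |Q|$. (b) Let $\psi \in \operatorname{Hom}(Q,P)$ and $\mathfrak{p}_\psi=(x_{\psi(q),q} : q\in Q)$. Then $\mathfrak{p}_\psi \in \operatorname{Min}(L(P,Q))$ if and only if for every $\phi \in \operatorname{Hom}(P,Q)$, the map $\psi \circ \phi$ has a fixed point. In particular, $\operatorname{height} (L(P,Q))=|Q|$ and $\dim \mathbb{K}[P,Q]=|Q|\cdot(|P|-1)$.
   Context: All posets are finite and nonempty; $\mathbb{K}$ is an arbitrary field. $\operatorname{Hom}(P,Q)$ is the set of order-preserving maps $P\to Q$. $S_{P,Q}=\mathbb{K}[x_{p,q} : p\in P, q\in Q]$, $u_\phi=\prod_{p\in P}x_{p,\phi(p)}$, $L(P,Q)=(u_\phi : \phi\in \operatorname{Hom}(P,Q))\subseteq S_{P,Q}$ and $\mathbb{K}[P,Q]=S_{P,Q}/L(P,Q)$. $\operatorname{Min}(I)$ is the set of minimal primes of $I$; $\dim$ is Krull dimension. *)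

theory Defs
  imports
    "HOL-Algebra.QuotRing"
    "HOL-Algebra.Algebraic_Closure_Type"
    "HOL-Library.Poly_Mapping"
    "HOL-Library.Extended_Nat"
    "HOL-Library.Cardinality"
begin

section \<open>Minimal primes, height and Krull dimension\<close>

definition prime_chain :: "('a, 'b) ring_scheme \<Rightarrow> nat \<Rightarrow> (nat \<Rightarrow> 'a set) \<Rightarrow> bool" where
  "prime_chain R n c \<longleftrightarrow>
     (\<forall>i\<le>n. primeideal (c i) R) \<and> (\<forall>i<n. c i \<subset> c (Suc i))"

text \<open>For the zero ring this yields 0, the supremum of the empty set in \<^typ>\<open>enat\<close>.\<close>

definition krull_dim :: "('a, 'b) ring_scheme \<Rightarrow> enat" where
  "krull_dim R = Sup {enat n | n. \<exists>c. prime_chain R n c}"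

definition prime_height :: "('a, 'b) ring_scheme \<Rightarrow> 'a set \<Rightarrow> enat" where
  "prime_height R \<pp> = Sup {enat n | n. \<exists>c. prime_chain R n c \<and> c n = \<pp>}"

definition ideal_height :: "('a, 'b) ring_scheme \<Rightarrow> 'a set \<Rightarrow> enat" where
  "ideal_height R I = Inf {prime_height R \<pp> | \<pp>. primeideal \<pp> R \<and> I \<subseteq> \<pp>}"

definition min_primes :: "('a, 'b) ring_scheme \<Rightarrow> 'a set \<Rightarrow> 'a set set" where
  "min_primes R I =
     {\<pp>. primeideal \<pp> R \<and> I \<subseteq> \<pp> \<and>
          (\<forall>\<qq>. primeideal \<qq> R \<and> I \<subseteq> \<qq> \<and> \<qq> \<subseteq> \<pp> \<longrightarrow> \<qq> = \<pp>)}"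

section \<open>The ideal of order-preserving maps between two finite posets\<close>

text \<open>
  Finite nonempty posets are types of class \<open>{finite, order}\<close>. The polynomial ring over
  \<open>'k\<close> in the variables \<open>x\<^bsub>p,q\<^esub>\<close> consists of the finitely supported maps from
  exponent vectors \<open>'p \<times> 'q \<Rightarrow>\<^sub>0 nat\<close> to \<open>'k\<close>, with the convolution product.
\<close>

type_synonym ('p, 'q, 'k) hom_poly = "(('p \<times> 'q) \<Rightarrow>\<^sub>0 nat) \<Rightarrow>\<^sub>0 'k"

definition hom_var :: "'p \<Rightarrow> 'q \<Rightarrow> ('p, 'q, 'k::field) hom_poly" where
  "hom_var p q = Poly_Mapping.single (Poly_Mapping.single (p, q) 1) 1"

abbreviation hom_poly_ring :: "('p, 'q, 'k::field) hom_poly ring" where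
  "hom_poly_ring \<equiv> ring_of_type_algebra"

definition hom_monomial :: "('p::finite \<Rightarrow> 'q) \<Rightarrow> ('p, 'q, 'k::field) hom_poly" where
  "hom_monomial \<phi> = (\<Prod>p\<in>UNIV. hom_var p (\<phi> p))"

definition hom_ideal :: "('p::{finite,order}, 'q::{finite,order}, 'k::field) hom_poly set" where
  "hom_ideal = Idl\<^bsub>hom_poly_ring\<^esub> {hom_monomial \<phi> | \<phi>. mono \<phi>}"

definition graph_ideal ::
    "('q \<Rightarrow> 'p) \<Rightarrow> ('p::{finite,order}, 'q::{finite,order}, 'k::field) hom_poly set" where
  "graph_ideal \<psi> = Idl\<^bsub>hom_poly_ring\<^esub> {hom_var (\<psi> q) q | q. True}"

definition hom_quotient_ring ::
    "('p::{finite,order}, 'q::{finite,order}, 'k::field) hom_poly set ring" where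
  "hom_quotient_ring = hom_poly_ring Quot hom_ideal"

end

theory Submission
  imports Defs
begin

text \<open>
  If \<open>x\<^sub>i\<close> lies in the \<open>i\<close>-th but not in the preceding prime of a chain of primes in a polynomial
  ring over a field, then the \<open>x\<^sub>i\<close> are algebraically independent: dividing a relation by the
  highest possible power of \<open>x\<^sub>1\<close> and reducing modulo the next prime leaves a relation among the
  remaining ones. Counting monomials shows that there are at most as many of them as variables,
  so this number bounds the length of all chains. Since the primes generated by sets of variables
  refine to a chain of maximal length, the heights and the dimension can be read off from the
  variables contained in a prime. A prime containing the ideal contains a variable from the
  (pairwise disjoint) graphs of all constant maps, hence a \<open>graph_ideal \<psi>\<close>.
\<close>

section \<open>Prime ideals of type-class rings\<close>

text \<open>Closure under negation comes from multiplication by \<open>- 1\<close>. This lets primes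
  of polynomial rings be handled with the type-class operations.\<close>

lemma primeideal_type_algebra_iff:
  fixes I :: "'a::comm_ring_1 set"
  shows "primeideal I ring_of_type_algebra \<longleftrightarrow>
    0 \<in> I \<and> (\<forall>a\<in>I. \<forall>b\<in>I. a + b \<in> I) \<and> (\<forall>a\<in>I. \<forall>x. x * a \<in> I) \<and>
    1 \<notin> I \<and> (\<forall>a b. a * b \<in> I \<longrightarrow> a \<in> I \<or> b \<in> I)"
    (is "?L \<longleftrightarrow> ?R")
proof
  assume L: ?L
  interpret primeideal I "ring_of_type_algebra :: 'a ring" by (fact L)
  have 1: "1 \<notin> I"
    using one_imp_carrier I_notcarr by (auto simp: ring_of_type_algebra_def)
  show ?R
    using additive_subgroup.zero_closed[OF is_additive_subgroup]
      additive_subgroup.a_closed[OF is_additive_subgroup] I_l_closed I_prime 1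
    by (auto simp: ring_of_type_algebra_def)
next
  assume R: ?R
  have neg: "- a \<in> I" if "a \<in> I" for a
    using R that by (metis mult_minus1)
  have sub: "additive_subgroup I (ring_of_type_algebra :: 'a ring)"
  proof
    show "inv\<^bsub>add_monoid (ring_of_type_algebra :: 'a ring)\<^esub> x \<in> I" if "x \<in> I" for x
    proof -
      interpret ring "ring_of_type_algebra :: 'a ring" by (rule ring_from_type_algebra)
      have "inv\<^bsub>add_monoid (ring_of_type_algebra :: 'a ring)\<^esub> x = - x"
        using add.inv_equality[of "- x" x] unfolding a_inv_def by (simp add: ring_of_type_algebra_def)
      then show ?thesis using neg that by simp
    qed
  qed (use R in \<open>auto simp: ring_of_type_algebra_def\<close>)
  show ?L
  proof (rule primeidealI2[OF sub cring_from_type_algebra])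
    show "carrier ring_of_type_algebra \<noteq> I"
      using R by (auto simp: ring_of_type_algebra_def)
  qed (use R in \<open>auto simp: ring_of_type_algebra_def mult.commute\<close>)
qed

context
  fixes I :: "'a::comm_ring_1 set"
  assumes I: "primeideal I ring_of_type_algebra"
begin

lemma type_prime_zero: "0 \<in> I"
  and type_prime_add: "a \<in> I \<Longrightarrow> b \<in> I \<Longrightarrow> a + b \<in> I"
  and type_prime_mult: "a \<in> I \<Longrightarrow> x * a \<in> I"
  and type_prime_one: "1 \<notin> I"
  and type_prime_prime: "a * b \<in> I \<Longrightarrow> a \<in> I \<or> b \<in> I"
  using I unfolding primeideal_type_algebra_iff by blast+

lemma type_prime_sum: "(\<And>i. i \<in> A \<Longrightarrow> f i \<in> I) \<Longrightarrow> sum f A \<in> I"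
  by (induction A rule: infinite_finite_induct) (auto simp: type_prime_zero type_prime_add)

lemma type_prime_power: "a ^ n \<in> I \<Longrightarrow> a \<in> I"
  by (induction n) (use type_prime_one type_prime_prime in auto)

lemma type_prime_prod: "finite A \<Longrightarrow> prod f A \<in> I \<Longrightarrow> \<exists>i\<in>A. f i \<in> I"
  by (induction A rule: finite_induct) (use type_prime_one type_prime_prime in auto)

lemma type_prime_dvd: "a dvd b \<Longrightarrow> a \<in> I \<Longrightarrow> b \<in> I"
  using type_prime_mult by (metis dvdE mult.commute)

lemma type_prime_diff: "a + b \<in> I \<Longrightarrow> b \<in> I \<Longrightarrow> a \<in> I"
  using type_prime_add[of "a + b" "- 1 * b"] type_prime_mult[of b "- 1"] by simp

end

section \<open>Chains of primes and algebraic independence\<close>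

text \<open>A monomial in the elements \<open>xs\<close>. Lists let an induction peel off the first
  element together with its exponent.\<close>

definition power_product :: "'a::comm_monoid_mult list \<Rightarrow> nat list \<Rightarrow> 'a" where
  "power_product xs e = prod_list (map2 (^) xs e)"

lemma power_product_Cons [simp]:
  "power_product (x # xs) (k # e) = x ^ k * power_product xs e"
  by (simp add: power_product_def)

lemma power_product_Nil [simp]: "power_product [] e = 1"
  by (simp add: power_product_def)

text \<open>Unit coefficients take the place of nonzero scalars: a unit avoids every prime, so none
  is lost when the induction on \<open>xs\<close> passes from \<open>c\<close> to the shifted chain
  starting at \<open>c 1\<close>.\<close>

lemma prime_chain_power_products_independent:
  fixes c :: "nat \<Rightarrow> 'a::comm_ring_1 set"
  assumes "prime_chain ring_of_type_algebra (length xs) c"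
    and "\<And>i. i < length xs \<Longrightarrow> xs ! i \<in> c (Suc i) - c i"
    and "finite E" "E \<noteq> {}" "\<And>e. e \<in> E \<Longrightarrow> length e = length xs"
    and "\<And>e. e \<in> E \<Longrightarrow> u e dvd 1"
  shows "(\<Sum>e\<in>E. u e * power_product xs e) \<notin> c 0"
  using assms
proof (induction xs arbitrary: c E u)
  case Nil
  then have E: "E = {[]}" by auto
  have P: "primeideal (c 0) ring_of_type_algebra"
    using Nil.prems(1) by (auto simp: prime_chain_def)
  have "u [] dvd 1"
    using Nil.prems(6) E by simp
  then show ?case
    using type_prime_dvd[OF P] type_prime_one[OF P] by (auto simp: E)
next
  case (Cons y ys)
  have P: "primeideal (c i) ring_of_type_algebra" if "i \<le> Suc (length ys)" for i
    using Cons.prems(1) that by (auto simp: prime_chain_def)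
  have c01: "c 0 \<subseteq> c 1"
    using Cons.prems(1) by (auto simp: prime_chain_def)
  have y: "y \<in> c 1" "y \<notin> c 0"
    using Cons.prems(2)[of 0] by auto
  \<comment> \<open>The least exponent of \<open>y\<close> in the relation. The factor
    \<open>y ^ m\<close> splits off every term and is cancelled because \<open>y\<close> lies
    outside the prime \<open>c 0\<close>.\<close>
  define m where "m = Min (hd ` E)"
  define E0 where "E0 = {e \<in> E. hd e = m}"
  have mE: "m \<le> hd e" if "e \<in> E" for e
    using that Cons.prems(3) by (auto simp: m_def)
  have eq: "e = hd e # tl e" if "e \<in> E" for e
    using Cons.prems(5)[OF that] by (cases e) auto
  define g where "g e = u e * (y ^ (hd e - m) * power_product ys (tl e))" for e
  show ?case
  proof
    assume "(\<Sum>e\<in>E. u e * power_product (y # ys) e) \<in> c 0"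
    also have "(\<Sum>e\<in>E. u e * power_product (y # ys) e) = (\<Sum>e\<in>E. y ^ m * g e)"
    proof (rule sum.cong[OF refl])
      fix e assume e: "e \<in> E"
      have "y ^ hd e = y ^ m * y ^ (hd e - m)"
        using mE[OF e] by (simp flip: power_add)
      then show "u e * power_product (y # ys) e = y ^ m * g e"
        using power_product_Cons[of y ys "hd e" "tl e"] eq[OF e]
        by (simp add: g_def mult_ac)
    qed
    also have "\<dots> = y ^ m * sum g E"
      by (simp add: sum_distrib_left)
    finally have "sum g E \<in> c 0"
      using type_prime_prime[OF P] type_prime_power[OF P] y(2) by blast
    then have "sum g E \<in> c 1"
      using c01 by blast
    \<comment> \<open>Terms with a larger exponent keep a factor \<open>y\<close> and vanish modulo
      \<open>c 1\<close>; those over \<open>E0\<close>, now free of \<open>y\<close>,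
      survive.\<close>
    moreover have "sum g (E - E0) \<in> c 1"
    proof (rule type_prime_sum[OF P])
      fix e assume "e \<in> E - E0"
      then have "hd e - m \<noteq> 0"
        using mE[of e] by (auto simp: E0_def)
      then have "y dvd g e"
        by (auto simp: g_def intro!: dvd_mult dvd_mult2 dvd_power)
      then show "g e \<in> c 1"
        using type_prime_dvd[OF P] y(1) by auto
    qed simp
    moreover have "sum g E = sum g E0 + sum g (E - E0)"
      using Cons.prems(3) by (subst add.commute, intro sum.subset_diff) (auto simp: E0_def)
    ultimately have in1: "sum g E0 \<in> c 1"
      using type_prime_diff[OF P] by simp
    \<comment> \<open>All heads in \<open>E0\<close> equal \<open>m\<close>, so the coefficient
      belonging to a tail \<open>f\<close> is \<open>u (m # f)\<close>.\<close>
    have inj: "inj_on tl E0"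
      by (rule inj_onI) (metis (mono_tags, lifting) E0_def eq mem_Collect_eq)
    have "sum g E0 = (\<Sum>f\<in>tl ` E0. u (m # f) * power_product ys f)"
      unfolding sum.reindex[OF inj] o_def
    proof (rule sum.cong[OF refl])
      fix e assume e: "e \<in> E0"
      then have "m # tl e = e"
        using eq[of e] by (simp add: E0_def)
      then show "g e = u (m # tl e) * power_product ys (tl e)"
        using e by (simp add: g_def E0_def)
    qed
    moreover have "(\<Sum>f\<in>tl ` E0. u (m # f) * power_product ys f) \<notin> c (Suc 0)"
    proof (rule Cons.IH)
      show "prime_chain ring_of_type_algebra (length ys) (\<lambda>i. c (Suc i))"
        using Cons.prems(1) by (auto simp: prime_chain_def)
      show "ys ! i \<in> c (Suc (Suc i)) - c (Suc i)" if "i < length ys" for i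
        using Cons.prems(2)[of "Suc i"] that by simp
      show "finite (tl ` E0)"
        using Cons.prems(3) by (simp add: E0_def)
      have "m \<in> hd ` E"
        unfolding m_def using Cons.prems(3,4) by (intro Min_in) auto
      then show "tl ` E0 \<noteq> {}"
        by (auto simp: E0_def)
      show "length f = length ys" if "f \<in> tl ` E0" for f
        using that Cons.prems(5) by (auto simp: E0_def)
      show "u (m # f) dvd 1" if "f \<in> tl ` E0" for f
      proof -
        from that obtain e where "e \<in> E" "hd e = m" "f = tl e"
          by (auto simp: E0_def)
        then show ?thesis
          using eq[of e] Cons.prems(6)[of e] by simp
      qed
    qed
    ultimately show False
      using in1 by simp
  qed
qed

section \<open>Counting monomials\<close>

text \<open>A bound on each exponent separately instead of the total degree: it is additive under
  products, and the exponent vectors below it are counted by a plain power.\<close>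

definition exponents_le :: "nat \<Rightarrow> (('v \<Rightarrow>\<^sub>0 nat) \<Rightarrow>\<^sub>0 'k::zero) \<Rightarrow> bool" where
  "exponents_le B f \<longleftrightarrow> (\<forall>m\<in>Poly_Mapping.keys f. \<forall>v. Poly_Mapping.lookup m v \<le> B)"

lemma exponents_le_mono: "exponents_le A f \<Longrightarrow> A \<le> B \<Longrightarrow> exponents_le B f"
  by (auto simp: exponents_le_def intro: order_trans)

lemma exponents_le_one: "exponents_le B 1"
  by (simp add: exponents_le_def)

lemma exponents_le_mult:
  fixes f g :: "('v \<Rightarrow>\<^sub>0 nat) \<Rightarrow>\<^sub>0 'k::semiring_0"
  assumes "exponents_le A f" "exponents_le B g"
  shows "exponents_le (A + B) (f * g)"
  unfolding exponents_le_def
proof safe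
  fix m v assume "m \<in> Poly_Mapping.keys (f * g)"
  then obtain a b where "m = a + b" "a \<in> Poly_Mapping.keys f" "b \<in> Poly_Mapping.keys g"
    using keys_mult by blast
  then show "Poly_Mapping.lookup m v \<le> A + B"
    using assms by (auto simp: exponents_le_def lookup_add intro: add_mono)
qed

lemma exponents_le_power:
  fixes f :: "('v \<Rightarrow>\<^sub>0 nat) \<Rightarrow>\<^sub>0 'k::comm_semiring_1"
  assumes "exponents_le A f"
  shows "exponents_le (n * A) (f ^ n)"
  by (induction n) (use assms exponents_le_mult[OF assms] in \<open>auto simp: exponents_le_one\<close>)

text \<open>Each of the \<open>length xs\<close> factors contributes at most \<open>D * A\<close>.
  The counting argument relies on this being linear in \<open>D\<close>.\<close>

lemma exponents_le_power_product:
  fixes xs :: "(('v \<Rightarrow>\<^sub>0 nat) \<Rightarrow>\<^sub>0 'k::comm_semiring_1) list"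
  assumes "length e = length xs" "\<And>x. x \<in> set xs \<Longrightarrow> exponents_le A x"
    and "\<And>k. k \<in> set e \<Longrightarrow> k \<le> D"
  shows "exponents_le (length xs * (D * A)) (power_product xs e)"
  using assms
proof (induction e xs rule: list_induct2)
  case (Cons k e x xs)
  have "exponents_le (k * A) (x ^ k)"
    using Cons.prems by (intro exponents_le_power) auto
  then have "exponents_le (D * A) (x ^ k)"
    by (rule exponents_le_mono) (use Cons.prems in auto)
  from exponents_le_mult[OF this Cons.IH] Cons.prems show ?case
    by auto
qed (auto simp: exponents_le_one)

lemma exponents_le_exists:
  fixes f :: "('v::finite \<Rightarrow>\<^sub>0 nat) \<Rightarrow>\<^sub>0 'k::zero"
  shows "\<exists>B. exponents_le B f"
proof -
  let ?S = "(\<lambda>(m, v). Poly_Mapping.lookup m v) ` (Poly_Mapping.keys f \<times> UNIV)"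
  have fin: "finite ?S" by simp
  have "exponents_le (Max ?S) f"
    unfolding exponents_le_def
  proof safe
    fix m v assume "m \<in> Poly_Mapping.keys f"
    then show "Poly_Mapping.lookup m v \<le> Max ?S"
      by (intro Max_ge[OF fin]) force
  qed
  then show ?thesis ..
qed

lemma bounded_exponents:
  shows finite_bounded_exponents: "finite {m :: 'v::finite \<Rightarrow>\<^sub>0 nat. \<forall>v. Poly_Mapping.lookup m v \<le> B}"
    and card_bounded_exponents:
      "card {m :: 'v::finite \<Rightarrow>\<^sub>0 nat. \<forall>v. Poly_Mapping.lookup m v \<le> B} \<le> (B + 1) ^ CARD('v)"
proof -
  let ?M = "{m :: 'v \<Rightarrow>\<^sub>0 nat. \<forall>v. Poly_Mapping.lookup m v \<le> B}"
  let ?F = "PiE (UNIV :: 'v set) (\<lambda>_. {..B})"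
  have inj: "inj_on Poly_Mapping.lookup ?M"
    by (auto intro!: inj_onI poly_mapping_eqI)
  have sub: "Poly_Mapping.lookup ` ?M \<subseteq> ?F"
    by auto
  have finF: "finite ?F"
    by (intro finite_PiE) auto
  show "finite ?M"
    using inj_on_finite[OF inj sub finF] .
  show "card ?M \<le> (B + 1) ^ CARD('v)"
    using card_inj_on_le[OF inj sub finF] by (simp add: card_PiE)
qed

lemma sum_singles: "f = (\<Sum>m\<in>Poly_Mapping.keys f. Poly_Mapping.single m (Poly_Mapping.lookup f m))"
  by (rule poly_mapping_eqI)
     (auto simp: lookup_sum lookup_single when_def in_keys_iff)

section \<open>Linear dependence over the coefficient field\<close>

lemma vector_space_single_zero:
  "vector_space (\<lambda>(a :: 'k::field) f :: ('v \<Rightarrow>\<^sub>0 nat) \<Rightarrow>\<^sub>0 'k. Poly_Mapping.single 0 a * f)"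
proof
  fix a b :: 'k and f :: "('v \<Rightarrow>\<^sub>0 nat) \<Rightarrow>\<^sub>0 'k"
  have "Poly_Mapping.single 0 (a * b) = Poly_Mapping.single 0 a * Poly_Mapping.single (0 :: 'v \<Rightarrow>\<^sub>0 nat) b"
    by (simp add: mult_single)
  then show "Poly_Mapping.single 0 a * (Poly_Mapping.single 0 b * f) = Poly_Mapping.single 0 (a * b) * f"
    by (simp add: mult.assoc)
qed (simp_all add: distrib_left distrib_right single_add)

text \<open>With exponents up to \<open>D\<close> there are \<open>(D + 1) ^ length xs\<close>
  exponent lists, and their products lie in the span of the monomials with exponents up to a fixed
  multiple of \<open>D\<close>. The number of these grows only like \<open>D ^ CARD('v)\<close>, so
  a large \<open>D\<close> forces a linear relation.\<close>

lemma power_product_dependent: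
  fixes xs :: "(('v::finite \<Rightarrow>\<^sub>0 nat) \<Rightarrow>\<^sub>0 'k::field) list"
  assumes "length xs > CARD('v)"
  shows "\<exists>E u. finite E \<and> E \<noteq> {} \<and> (\<forall>e\<in>E. length e = length xs \<and> u e dvd 1) \<and>
    (\<Sum>e\<in>E. u e * power_product xs e) = 0"
proof -
  let ?N = "CARD('v)" and ?n = "length xs"
  obtain Bf where Bf: "\<And>f. exponents_le (Bf f) (f :: ('v \<Rightarrow>\<^sub>0 nat) \<Rightarrow>\<^sub>0 'k)"
    using exponents_le_exists by metis
  \<comment> \<open>\<open>Suc\<close> keeps \<open>A\<close> positive, so that
    \<open>?n * A\<close> is at least 1.\<close>
  define A where "A = Suc (\<Sum>f\<leftarrow>xs. Bf f)"
  have A: "exponents_le A f" if "f \<in> set xs" for f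
    by (rule exponents_le_mono[OF Bf]) (use that in \<open>auto simp: A_def intro!: le_SucI member_le_sum_list\<close>)
  \<comment> \<open>Chosen for the count: \<open>B + 1 \<le> ?n * A * (D + 1)\<close> below, hence
    \<open>(B + 1) ^ ?N \<le> D * (D + 1) ^ ?N\<close>, which is less than
    \<open>(D + 1) ^ Suc ?N\<close>.\<close>
  define D where "D = (?n * A) ^ ?N"
  define L where "L = {e. set e \<subseteq> {..D} \<and> length e = ?n}"
  define B where "B = ?n * (D * A)"
  define M where "M = {m :: 'v \<Rightarrow>\<^sub>0 nat. \<forall>v. Poly_Mapping.lookup m v \<le> B}"
  have finL: "finite L" and cardL: "card L = (D + 1) ^ ?n"
    unfolding L_def by (auto intro: finite_lists_length_eq simp: card_lists_length_eq)
  have pL: "Poly_Mapping.keys (power_product xs e) \<subseteq> M" if "e \<in> L" for e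
    using exponents_le_power_product[of e xs A D] that A
    by (auto simp: L_def B_def M_def exponents_le_def)
  have "1 \<le> ?n * A"
    using assms by (auto simp: A_def Suc_le_eq)
  then have "B + 1 \<le> (?n * A) * (D + 1)"
    by (simp add: B_def algebra_simps)
  then have "(B + 1) ^ ?N \<le> D * (D + 1) ^ ?N"
    unfolding D_def by (metis power_mono power_mult_distrib zero_le)
  also have "\<dots> < (D + 1) ^ Suc ?N"
    by simp
  also have "\<dots> \<le> (D + 1) ^ ?n"
    using assms by (intro power_increasing) auto
  finally have card_less: "(B + 1) ^ ?N < card L"
    using cardL by simp
  show ?thesis
  proof (cases "inj_on (power_product xs) L")
    \<comment> \<open>Two exponent lists with the same product already give a relation, with
      coefficients \<open>1\<close> and \<open>- 1\<close>. Dependence of the set of products would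
      not detect it.\<close>
    case False
    then obtain e e' where e: "e \<in> L" "e' \<in> L" "e \<noteq> e'" "power_product xs e = power_product xs e'"
      by (auto simp: inj_on_def)
    show ?thesis
      by (rule exI[of _ "{e, e'}"], rule exI[of _ "\<lambda>x. if x = e then 1 else - 1"])
         (use e in \<open>auto simp: L_def\<close>)
  next
    case inj: True
    define scale where "scale = (\<lambda>(a :: 'k) f :: ('v \<Rightarrow>\<^sub>0 nat) \<Rightarrow>\<^sub>0 'k. Poly_Mapping.single 0 a * f)"
    interpret V: vector_space scale
      unfolding scale_def by (rule vector_space_single_zero)
    have "power_product xs e \<in> V.span ((\<lambda>m. Poly_Mapping.single m 1) ` M)" if "e \<in> L" for e
    proof -
      have "(\<Sum>m\<in>Poly_Mapping.keys (power_product xs e).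
          scale (Poly_Mapping.lookup (power_product xs e) m) (Poly_Mapping.single m 1))
          \<in> V.span ((\<lambda>m. Poly_Mapping.single m 1) ` M)"
        using pL[OF that] by (intro V.span_sum V.span_scale V.span_base) auto
      then show ?thesis
        by (simp add: scale_def mult_single flip: sum_singles)
    qed
    then have span: "power_product xs ` L \<subseteq> V.span ((\<lambda>m. Poly_Mapping.single m 1) ` M)"
      by auto
    have finM: "finite M" and cardM: "card M \<le> (B + 1) ^ ?N"
      unfolding M_def by (rule bounded_exponents)+
    have "V.dependent (power_product xs ` L)"
    proof (rule ccontr)
      assume "V.independent (power_product xs ` L)"
      from V.independent_span_bound[OF _ this span] finM
      have "card (power_product xs ` L) \<le> card ((\<lambda>m. Poly_Mapping.single m (1::'k)) ` M)"
        by simp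
      also have "\<dots> \<le> card M"
        using finM by (rule card_image_le)
      finally show False
        using cardM card_less card_image[OF inj] by simp
    qed
    then obtain w where w: "\<exists>v\<in>power_product xs ` L. w v \<noteq> 0"
        "(\<Sum>v\<in>power_product xs ` L. scale (w v) v) = 0"
      using V.dependent_finite finL by auto
    \<comment> \<open>Zero coefficients are dropped; the remaining ones are nonzero constants and
      hence units.\<close>
    define E where "E = {e \<in> L. w (power_product xs e) \<noteq> 0}"
    have "(\<Sum>e\<in>E. Poly_Mapping.single 0 (w (power_product xs e)) * power_product xs e)
        = (\<Sum>e\<in>L. scale (w (power_product xs e)) (power_product xs e))"
      unfolding E_def scale_def using finL by (intro sum.mono_neutral_left) auto
    also have "\<dots> = 0"
      using w(2) inj by (simp add: sum.reindex)
    finally have "(\<Sum>e\<in>E. Poly_Mapping.single 0 (w (power_product xs e)) * power_product xs e) = 0" .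
    moreover have "Poly_Mapping.single 0 a dvd (1 :: ('v \<Rightarrow>\<^sub>0 nat) \<Rightarrow>\<^sub>0 'k)" if "a \<noteq> 0" for a
      by (rule dvdI[of _ _ "Poly_Mapping.single 0 (inverse a)"]) (use that in \<open>simp add: mult_single\<close>)
    moreover have "finite E"
      using finL by (simp add: E_def)
    moreover have "E \<noteq> {}"
      using w(1) by (auto simp: E_def)
    moreover have "length e = ?n" "w (power_product xs e) \<noteq> 0" if "e \<in> E" for e
      using that by (simp_all add: E_def L_def)
    ultimately have "finite E \<and> E \<noteq> {} \<and>
        (\<forall>e\<in>E. length e = ?n \<and> Poly_Mapping.single 0 (w (power_product xs e)) dvd
          (1 :: ('v \<Rightarrow>\<^sub>0 nat) \<Rightarrow>\<^sub>0 'k)) \<and>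
        (\<Sum>e\<in>E. Poly_Mapping.single 0 (w (power_product xs e)) * power_product xs e) = 0"
      by simp
    then show ?thesis
      by (intro exI)
  qed
qed

text \<open>Each strict inclusion supplies an element of \<open>c (Suc i) - c i\<close>. If there
  were more of them than variables, a relation with unit coefficients would have the value
  \<open>0\<close>, which lies in \<open>c 0\<close>, against independence.\<close>

theorem prime_chain_length_le:
  fixes c :: "nat \<Rightarrow> (('v::finite \<Rightarrow>\<^sub>0 nat) \<Rightarrow>\<^sub>0 'k::field) set"
  assumes c: "prime_chain ring_of_type_algebra n c"
  shows "n \<le> CARD('v)"
proof (rule ccontr)
  assume n: "\<not> n \<le> CARD('v)"
  have "\<exists>x. x \<in> c (Suc i) - c i" if "i < n" for i
    using c that by (auto simp: prime_chain_def)
  then obtain x where x: "\<And>i. i < n \<Longrightarrow> x i \<in> c (Suc i) - c i"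
    by metis
  let ?xs = "map x [0..<n]"
  have "length ?xs > CARD('v)"
    using n by simp
  from power_product_dependent[OF this] obtain E u
    where E: "finite E \<and> E \<noteq> {} \<and> (\<forall>e\<in>E. length e = length ?xs \<and> u e dvd 1) \<and>
      (\<Sum>e\<in>E. u e * power_product ?xs e) = 0"
    by (elim exE)
  have "(\<Sum>e\<in>E. u e * power_product ?xs e) \<notin> c 0"
    using c x E by (intro prime_chain_power_products_independent) simp_all
  moreover have "0 \<in> c 0"
    using c by (intro type_prime_zero) (auto simp: prime_chain_def)
  ultimately show False
    using E by simp
qed

section \<open>Ideals generated by variables\<close>

definition pvar :: "'v \<Rightarrow> ('v \<Rightarrow>\<^sub>0 nat) \<Rightarrow>\<^sub>0 'k::comm_semiring_1" where
  "pvar v = Poly_Mapping.single (Poly_Mapping.single v 1) 1"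

text \<open>The ideal generated by the variables in \<open>T\<close> (see
  \<open>genideal_var\<close>), encoded by supports so that membership is tested one monomial at a
  time.\<close>

definition var_ideal :: "'v set \<Rightarrow> (('v \<Rightarrow>\<^sub>0 nat) \<Rightarrow>\<^sub>0 'k::comm_semiring_1) set" where
  "var_ideal T = {f. \<forall>m\<in>Poly_Mapping.keys f. \<exists>v\<in>T. Poly_Mapping.lookup m v \<noteq> 0}"

lemma pvar_in_var_ideal_iff [simp]:
  "(pvar v :: ('v \<Rightarrow>\<^sub>0 nat) \<Rightarrow>\<^sub>0 'k::comm_semiring_1) \<in> var_ideal T \<longleftrightarrow> v \<in> T"
  by (auto simp: pvar_def var_ideal_def lookup_single when_def)

lemma var_ideal_mono: "T \<subseteq> U \<Longrightarrow> var_ideal T \<subseteq> var_ideal U"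
  unfolding var_ideal_def by blast

lemma var_ideal_psubset:
  assumes "T \<subset> U"
  shows "var_ideal T \<subset> (var_ideal U :: (('v \<Rightarrow>\<^sub>0 nat) \<Rightarrow>\<^sub>0 'k::comm_semiring_1) set)"
proof -
  from assms obtain v where "v \<in> U" "v \<notin> T" by blast
  then have "(pvar v :: ('v \<Rightarrow>\<^sub>0 nat) \<Rightarrow>\<^sub>0 'k) \<in> var_ideal U - var_ideal T" by simp
  then show ?thesis using var_ideal_mono[of T U] assms by blast
qed

lemma var_ideal_mult:
  fixes f g :: "('v \<Rightarrow>\<^sub>0 nat) \<Rightarrow>\<^sub>0 'k::comm_ring_1"
  assumes "f \<in> var_ideal T"
  shows "g * f \<in> var_ideal T"
  unfolding var_ideal_def mem_Collect_eq
proof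
  fix m assume "m \<in> Poly_Mapping.keys (g * f)"
  then obtain a b where "m = a + b" "b \<in> Poly_Mapping.keys f"
    using keys_mult by blast
  with assms show "\<exists>v\<in>T. Poly_Mapping.lookup m v \<noteq> 0"
    by (auto simp: var_ideal_def lookup_add)
qed

lemma var_ideal_add:
  "f \<in> var_ideal T \<Longrightarrow> g \<in> var_ideal T \<Longrightarrow> f + g \<in> var_ideal T"
  using keys_add[of f g] by (auto simp: var_ideal_def)

section \<open>Primality of ideals generated by variables\<close>

text \<open>Numbering the variables carries exponent vectors into a monoid whose lexicographic order
  is linear and compatible with addition. Injectivity turns equal weights back into equal
  monomials.\<close>

lemma exponent_weight:
  obtains w :: "('v::finite \<Rightarrow>\<^sub>0 nat) \<Rightarrow> (nat \<Rightarrow>\<^sub>0 nat)"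
  where "inj w" "\<And>a b. w (a + b) = w a + w b"
proof -
  obtain idx :: "'v \<Rightarrow> nat" where idx: "inj idx"
    using finite_imp_inj_to_nat_seg[of "UNIV :: 'v set"] by auto
  define w where "w m = (\<Sum>v\<in>UNIV. Poly_Mapping.single (idx v) (Poly_Mapping.lookup m v))"
    for m :: "'v \<Rightarrow>\<^sub>0 nat"
  have lookup_w: "Poly_Mapping.lookup (w m) (idx v) = Poly_Mapping.lookup m v" for m v
    using idx by (simp add: w_def lookup_sum lookup_single when_def inj_eq)
  show ?thesis
  proof
    show "inj w"
      by (rule injI, rule poly_mapping_eqI) (metis lookup_w)
    show "w (a + b) = w a + w b" for a b
      by (simp add: w_def lookup_add single_add sum.distrib)
  qed
qed

text \<open>The leading monomials of the parts of \<open>f\<close> and \<open>g\<close> outside the ideal, with respect to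
  the lexicographic order, cannot cancel in \<open>f * g\<close>.\<close>

lemma var_ideal_prime:
  fixes f g :: "('v::finite \<Rightarrow>\<^sub>0 nat) \<Rightarrow>\<^sub>0 'k::idom"
  assumes "f * g \<in> var_ideal T"
  shows "f \<in> var_ideal T \<or> g \<in> var_ideal T"
proof (rule ccontr)
  assume neg: "\<not> (f \<in> var_ideal T \<or> g \<in> var_ideal T)"
  obtain w :: "('v \<Rightarrow>\<^sub>0 nat) \<Rightarrow> (nat \<Rightarrow>\<^sub>0 nat)"
    where inj: "inj w" and w_add: "\<And>a b. w (a + b) = w a + w b"
    using exponent_weight by blast
  \<comment> \<open>\<open>K h\<close> is the support of \<open>h\<close> modulo the ideal.\<close>
  define K where "K h = {m \<in> Poly_Mapping.keys h. \<forall>v\<in>T. Poly_Mapping.lookup m v = 0}"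
    for h :: "('v \<Rightarrow>\<^sub>0 nat) \<Rightarrow>\<^sub>0 'k"
  have leading: "\<exists>a\<in>K h. \<forall>b\<in>K h. w b \<le> w a" if "h \<notin> var_ideal T" for h
  proof -
    have fin: "finite (w ` K h)" and ne: "w ` K h \<noteq> {}"
      using that by (auto simp: K_def var_ideal_def)
    from Max_in[OF fin ne] obtain a where "a \<in> K h" "w a = Max (w ` K h)"
      by auto
    then show ?thesis
      using Max_ge[OF fin] by (intro bexI[of _ a] ballI) simp_all
  qed
  obtain a where a: "a \<in> K f" "\<And>x. x \<in> K f \<Longrightarrow> w x \<le> w a"
    using leading[of f] neg by auto
  obtain b where b: "b \<in> K g" "\<And>x. x \<in> K g \<Longrightarrow> w x \<le> w b"
    using leading[of g] neg by auto
  \<comment> \<open>Exponents are natural numbers and those of \<open>a + b\<close> vanish on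
    \<open>T\<close>, so \<open>x\<close> and \<open>y\<close> avoid \<open>T\<close> too and their
    weights are at most those of \<open>a\<close> and \<open>b\<close>. Equality of the sums then
    forces equality of each. Thus only one pair of terms contributes to the monomial
    \<open>a + b\<close> of \<open>f * g\<close>.\<close>
  have unique: "x = a \<and> y = b"
    if "Poly_Mapping.lookup f x \<noteq> 0" "Poly_Mapping.lookup g y \<noteq> 0" "a + b = x + y" for x y
  proof -
    have "Poly_Mapping.lookup x v = 0 \<and> Poly_Mapping.lookup y v = 0" if "v \<in> T" for v
    proof -
      have "Poly_Mapping.lookup (a + b) v = 0"
        using a(1) b(1) that by (simp add: K_def lookup_add)
      then show ?thesis
        unfolding \<open>a + b = x + y\<close> by (simp add: lookup_add)
    qed
    then have "x \<in> K f" "y \<in> K g"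
      using that by (auto simp: K_def in_keys_iff)
    then have le: "w x \<le> w a" "w y \<le> w b"
      using a(2) b(2) by auto
    have eq: "w x + w y = w a + w b"
      using that(3) by (simp flip: w_add)
    have "w x = w a"
    proof (rule ccontr)
      assume "w x \<noteq> w a"
      then have "w x + w y < w a + w b"
        using le by (intro add_less_le_mono) auto
      then show False using eq by simp
    qed
    moreover from this have "w y = w b"
      using eq by simp
    ultimately show ?thesis
      using inj by (simp add: inj_eq)
  qed
  have inner: "(\<Sum>q. Poly_Mapping.lookup g q when a + b = x + q)
      = (if x = a then Poly_Mapping.lookup g b else 0)"
    if "Poly_Mapping.lookup f x \<noteq> 0" for x
  proof -
    have "(\<Sum>q. Poly_Mapping.lookup g q when a + b = x + q)
        = (\<Sum>q. Poly_Mapping.lookup g b when q = b \<and> x = a)"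
      by (rule Sum_any.cong) (use unique[OF that] in \<open>auto simp: when_def\<close>)
    also have "\<dots> = (if x = a then Poly_Mapping.lookup g b else 0)"
      by (auto simp: when_def)
    finally show ?thesis .
  qed
  have "Poly_Mapping.lookup (f * g) (a + b)
      = (\<Sum>x. (Poly_Mapping.lookup f a * Poly_Mapping.lookup g b) when x = a)"
    unfolding lookup_mult
  proof (rule Sum_any.cong)
    fix x
    show "Poly_Mapping.lookup f x * (\<Sum>q. Poly_Mapping.lookup g q when a + b = x + q)
        = (Poly_Mapping.lookup f a * Poly_Mapping.lookup g b when x = a)"
      using inner[of x] by (cases "Poly_Mapping.lookup f x = 0") (auto simp: when_def)
  qed
  also have "\<dots> = Poly_Mapping.lookup f a * Poly_Mapping.lookup g b"
    by simp
  finally have "a + b \<in> Poly_Mapping.keys (f * g)"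
    using a(1) b(1) by (simp add: K_def in_keys_iff)
  with assms have "\<exists>v\<in>T. Poly_Mapping.lookup (a + b) v \<noteq> 0"
    by (simp add: var_ideal_def)
  then show False
    using a(1) b(1) by (auto simp: K_def lookup_add)
qed

lemma primeideal_var_ideal:
  "primeideal (var_ideal T :: (('v::finite \<Rightarrow>\<^sub>0 nat) \<Rightarrow>\<^sub>0 'k::idom) set) ring_of_type_algebra"
  unfolding primeideal_type_algebra_iff
proof (intro conjI)
  show "1 \<notin> (var_ideal T :: (('v \<Rightarrow>\<^sub>0 nat) \<Rightarrow>\<^sub>0 'k) set)"
    by (simp add: var_ideal_def)
qed (auto simp: var_ideal_add var_ideal_mult dest: var_ideal_prime, simp add: var_ideal_def)

text \<open>Every term of an element of \<open>var_ideal T\<close> is a multiple of a variable in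
  \<open>T\<close>, and a polynomial is the sum of its terms.\<close>

lemma var_ideal_minimal:
  fixes J :: "(('v \<Rightarrow>\<^sub>0 nat) \<Rightarrow>\<^sub>0 'k::comm_ring_1) set"
  assumes "ideal J ring_of_type_algebra" "pvar ` T \<subseteq> J"
  shows "var_ideal T \<subseteq> J"
proof
  interpret ideal J "ring_of_type_algebra :: (('v \<Rightarrow>\<^sub>0 nat) \<Rightarrow>\<^sub>0 'k) ring" by (fact assms(1))
  have sum: "sum h S \<in> J" if "\<And>i. i \<in> S \<Longrightarrow> h i \<in> J" for h and S :: "('v \<Rightarrow>\<^sub>0 nat) set"
    using that
    by (induction S rule: infinite_finite_induct)
       (use additive_subgroup.zero_closed[OF is_additive_subgroup]
          additive_subgroup.a_closed[OF is_additive_subgroup]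
        in \<open>auto simp: ring_of_type_algebra_def\<close>)
  fix f :: "('v \<Rightarrow>\<^sub>0 nat) \<Rightarrow>\<^sub>0 'k" assume f: "f \<in> var_ideal T"
  have "Poly_Mapping.single m (Poly_Mapping.lookup f m) \<in> J" if m: "m \<in> Poly_Mapping.keys f" for m
  proof -
    from f m obtain v where v: "v \<in> T" "Poly_Mapping.lookup m v \<noteq> 0"
      by (auto simp: var_ideal_def)
    \<comment> \<open>The truncated subtraction of exponents is exact here because \<open>v\<close>
      occurs in \<open>m\<close>.\<close>
    have "(m - Poly_Mapping.single v 1) + Poly_Mapping.single v 1 = m"
      by (rule poly_mapping_eqI) (use v(2) in \<open>auto simp: lookup_add lookup_minus lookup_single when_def\<close>)
    then have "Poly_Mapping.single m (Poly_Mapping.lookup f m)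
        = Poly_Mapping.single (m - Poly_Mapping.single v 1) (Poly_Mapping.lookup f m) * pvar v"
      by (simp add: pvar_def mult_single)
    then show ?thesis
      using I_l_closed[of "pvar v"] assms(2) v(1) by (auto simp: ring_of_type_algebra_def)
  qed
  then show "f \<in> J"
    by (subst sum_singles) (rule sum)
qed

lemma genideal_var:
  "Idl\<^bsub>ring_of_type_algebra\<^esub> (pvar ` T) = (var_ideal T :: (('v::finite \<Rightarrow>\<^sub>0 nat) \<Rightarrow>\<^sub>0 'k::idom) set)"
proof -
  interpret ring "ring_of_type_algebra :: (('v \<Rightarrow>\<^sub>0 nat) \<Rightarrow>\<^sub>0 'k) ring"
    by (rule ring_from_type_algebra)
  have carrier: "A \<subseteq> carrier (ring_of_type_algebra :: (('v \<Rightarrow>\<^sub>0 nat) \<Rightarrow>\<^sub>0 'k) ring)" for A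
    by (simp add: ring_of_type_algebra_def)
  show ?thesis
  proof
    show "Idl\<^bsub>ring_of_type_algebra\<^esub> (pvar ` T) \<subseteq> (var_ideal T :: (('v \<Rightarrow>\<^sub>0 nat) \<Rightarrow>\<^sub>0 'k) set)"
      by (rule genideal_minimal[OF primeideal.axioms(1)[OF primeideal_var_ideal]]) auto
    show "(var_ideal T :: (('v \<Rightarrow>\<^sub>0 nat) \<Rightarrow>\<^sub>0 'k) set) \<subseteq> Idl\<^bsub>ring_of_type_algebra\<^esub> (pvar ` T)"
      by (rule var_ideal_minimal[OF genideal_ideal[OF carrier] genideal_self[OF carrier]])
  qed
qed

section \<open>Heights and dimensions\<close>

text \<open>The variables of \<open>U - T\<close> are adjoined one at a time along an enumeration
  \<open>h\<close>.\<close>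

lemma var_ideal_chain:
  fixes T U :: "'v::finite set"
  assumes "T \<subseteq> U"
  shows "\<exists>c. prime_chain ring_of_type_algebra (card (U - T)) c \<and> c 0 = var_ideal T \<and>
    c (card (U - T)) = (var_ideal U :: (('v \<Rightarrow>\<^sub>0 nat) \<Rightarrow>\<^sub>0 'k::idom) set)"
proof -
  let ?n = "card (U - T)"
  obtain h where h: "bij_betw h {..<?n} (U - T)"
    using ex_bij_betw_nat_finite[of "U - T"] by (auto simp: atLeast0LessThan)
  define c where "c i = (var_ideal (T \<union> h ` {..<i}) :: (('v \<Rightarrow>\<^sub>0 nat) \<Rightarrow>\<^sub>0 'k) set)" for i
  have "c i \<subset> c (Suc i)" if "i < ?n" for i
  proof -
    have "h i \<in> U - T"
      using h that by (auto simp: bij_betw_def)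
    moreover have "h i \<notin> h ` {..<i}"
      using inj_on_image_mem_iff[OF bij_betw_imp_inj_on[OF h], of i "{..<i}"] that by simp
    ultimately have "T \<union> h ` {..<i} \<subset> T \<union> h ` {..<Suc i}"
      by auto
    then show ?thesis
      unfolding c_def by (rule var_ideal_psubset)
  qed
  moreover have "T \<union> h ` {..<?n} = U"
    using h assms by (auto simp: bij_betw_def)
  ultimately show ?thesis
    by (intro exI[of _ c]) (auto simp: prime_chain_def primeideal_var_ideal c_def)
qed

text \<open>At the joint, \<open>d 0\<close> takes the place of \<open>c m\<close>. Hence a possibly
  non-strict inclusion suffices, and the length is \<open>m + n\<close>.\<close>

lemma prime_chain_append:
  assumes c: "prime_chain R m c" and d: "prime_chain R n d" and cd: "c m \<subseteq> d 0"
  shows "prime_chain R (m + n) (\<lambda>i. if i < m then c i else d (i - m))"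
  unfolding prime_chain_def
proof (intro conjI allI impI)
  fix i assume "i \<le> m + n"
  then show "primeideal (if i < m then c i else d (i - m)) R"
    using c d by (auto simp: prime_chain_def)
next
  fix i assume i: "i < m + n"
  consider "Suc i < m" | "Suc i = m" | "m \<le> i" by linarith
  then show "(if i < m then c i else d (i - m)) \<subset> (if Suc i < m then c (Suc i) else d (Suc i - m))"
  proof cases
    case 2
    then have "c i \<subset> c m"
      using c by (auto simp: prime_chain_def)
    then show ?thesis using 2 cd by auto
  next
    case 3
    then have "d (i - m) \<subset> d (Suc (i - m))"
      using d i by (auto simp: prime_chain_def)
    then show ?thesis using 3 by (simp add: Suc_diff_le)
  qed (use c in \<open>auto simp: prime_chain_def\<close>)
qed

lemma Sup_enat_eqI:
  assumes "P n" "\<And>m. P m \<Longrightarrow> m \<le> n"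
  shows "Sup {enat m | m. P m} = enat n"
  using assms by (intro antisym Sup_least Sup_upper) auto

lemma prime_chain_single: "primeideal I R \<Longrightarrow> prime_chain R 0 (\<lambda>_. I)"
  by (simp add: prime_chain_def)

text \<open>A chain from \<open>var_ideal {}\<close> to \<open>var_ideal T\<close> is joined to a
  chain of length 0, which only exchanges its top for \<open>\<pp>\<close>.\<close>

lemma le_prime_height:
  fixes \<pp> :: "(('v::finite \<Rightarrow>\<^sub>0 nat) \<Rightarrow>\<^sub>0 'k::idom) set"
  assumes "primeideal \<pp> ring_of_type_algebra" "var_ideal T \<subseteq> \<pp>"
  shows "enat (card T) \<le> prime_height ring_of_type_algebra \<pp>"
proof -
  obtain c where c: "prime_chain ring_of_type_algebra (card T) c"
      "c (card T) = (var_ideal T :: (('v \<Rightarrow>\<^sub>0 nat) \<Rightarrow>\<^sub>0 'k) set)"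
    using var_ideal_chain[of "{}" T] by auto
  have "prime_chain ring_of_type_algebra (card T + 0) (\<lambda>i. if i < card T then c i else \<pp>)"
    by (rule prime_chain_append[OF c(1) prime_chain_single[OF assms(1)]]) (simp add: c(2) assms(2))
  then show ?thesis
    unfolding prime_height_def by (intro Sup_upper CollectI exI[of _ "card T"]) auto
qed

text \<open>For the upper bound, a chain ending at \<open>var_ideal T\<close> is continued to
  \<open>var_ideal UNIV\<close> in \<open>card (UNIV - T)\<close> steps; the total length is at most
  the number of variables.\<close>

lemma prime_height_var_ideal:
  "prime_height ring_of_type_algebra (var_ideal T :: (('v::finite \<Rightarrow>\<^sub>0 nat) \<Rightarrow>\<^sub>0 'k::field) set)
    = enat (card T)"
proof (rule antisym)
  show "enat (card T) \<le> prime_height ring_of_type_algebra (var_ideal T :: (('v \<Rightarrow>\<^sub>0 nat) \<Rightarrow>\<^sub>0 'k) set)"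
    by (rule le_prime_height[OF primeideal_var_ideal order_refl])
  have "n \<le> card T"
    if c: "prime_chain ring_of_type_algebra n c" "c n = (var_ideal T :: (('v \<Rightarrow>\<^sub>0 nat) \<Rightarrow>\<^sub>0 'k) set)"
    for n c
  proof -
    obtain d where d: "prime_chain ring_of_type_algebra (card (UNIV - T)) d"
        "d 0 = (var_ideal T :: (('v \<Rightarrow>\<^sub>0 nat) \<Rightarrow>\<^sub>0 'k) set)"
      using var_ideal_chain[of T UNIV] by auto
    have "n + card (UNIV - T) \<le> CARD('v)"
      using prime_chain_append[OF c(1) d(1)] c(2) d(2) by (intro prime_chain_length_le) auto
    moreover have "card (UNIV - T) = CARD('v) - card T" "card T \<le> CARD('v)"
      by (simp_all add: card_Diff_subset card_mono)
    ultimately show ?thesis by linarith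
  qed
  then show "prime_height ring_of_type_algebra (var_ideal T :: (('v \<Rightarrow>\<^sub>0 nat) \<Rightarrow>\<^sub>0 'k) set) \<le> enat (card T)"
    unfolding prime_height_def by (intro Sup_least) auto
qed

section \<open>Prime chains in a quotient ring\<close>

text \<open>The chain consists of preimages under the projection, whose surjectivity keeps the
  inclusions strict.\<close>

lemma (in cring) prime_chain_quotient:
  assumes "prime_chain (R Quot I) n c" "ideal I R"
  shows "\<exists>d. prime_chain R n d \<and> I \<subseteq> d 0"
proof -
  interpret pr: ring_hom_ring R "R Quot I" "(+>) I"
    by (rule ideal.rcos_ring_hom_ring[OF assms(2)])
  define d where "d i = {r \<in> carrier R. I +> r \<in> c i}" for i
  have P: "primeideal (c i) (R Quot I)" if "i \<le> n" for i
    using assms(1) that by (auto simp: prime_chain_def)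
  have carr: "c i \<subseteq> carrier (R Quot I)" if "i \<le> n" for i
    using P[OF that] by (meson additive_subgroup.a_subset ideal.axioms(1) primeideal.axioms(1))
  have "primeideal (d i) R" if "i \<le> n" for i
    unfolding d_def using is_cring P[OF that] by (rule pr.primeideal_vimage)
  moreover have "d i \<subset> d (Suc i)" if "i < n" for i
  proof -
    have sub: "c i \<subset> c (Suc i)"
      using assms(1) that by (auto simp: prime_chain_def)
    then obtain A where A: "A \<in> c (Suc i)" "A \<notin> c i" by blast
    then have "A \<in> carrier (R Quot I)"
      using carr[of "Suc i"] that by (meson Suc_leI subsetD)
    then obtain r where r: "r \<in> carrier R" "A = I +> r"
      unfolding FactRing_def A_RCOSETS_def' by auto
    then have "r \<in> d (Suc i)" "r \<notin> d i"
      using A by (simp_all add: d_def)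
    moreover have "d i \<subseteq> d (Suc i)"
      using sub by (auto simp only: d_def)
    ultimately show ?thesis by blast
  qed
  moreover have "I \<subseteq> d 0"
  proof
    fix r assume r: "r \<in> I"
    have "\<zero>\<^bsub>R Quot I\<^esub> \<in> c 0"
      by (intro additive_subgroup.zero_closed ideal.axioms(1) primeideal.axioms(1) P) simp
    moreover have "\<zero>\<^bsub>R Quot I\<^esub> = I +> r"
      unfolding a_rcos_zero[OF assms(2) r] by (simp only: FactRing_def ring.select_convs)
    ultimately show "r \<in> d 0"
      using r ideal.Icarr[OF assms(2)] by (simp add: d_def)
  qed
  ultimately show ?thesis
    unfolding prime_chain_def by blast
qed

lemma (in cring) quotient_prime_chain:
  assumes d: "prime_chain R n d" and I: "ideal I R" "I \<subseteq> d 0"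
  shows "prime_chain (R Quot I) n (\<lambda>i. (+>) I ` d i)"
proof -
  have P: "primeideal (d i) R" if "i \<le> n" for i
    using d that by (auto simp: prime_chain_def)
  have sub: "I \<subseteq> d i" if "i \<le> n" for i
    using that
  proof (induction i)
    case (Suc i)
    then show ?case using d unfolding prime_chain_def
      by (metis Suc_le_lessD less_imp_le psubsetE subset_trans)
  qed (use I in auto)
  \<comment> \<open>An ideal containing \<open>I\<close> is a union of cosets of \<open>I\<close>,
    so the coset of \<open>r\<close> decides whether \<open>r\<close> belongs to it. Primality and
    strictness of the images both rest on this.\<close>
  have mem: "I +> r \<in> (+>) I ` d i \<longleftrightarrow> r \<in> d i" if "i \<le> n" "r \<in> carrier R" for i r
  proof
    assume "I +> r \<in> (+>) I ` d i"
    moreover have "r \<in> I +> r"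
      using additive_subgroup.zero_closed[OF ideal.axioms(1)[OF I(1)]] that(2)
      by (force simp: a_r_coset_def')
    ultimately have "r \<in> (\<Union>j\<in>d i. I +> j)"
      by auto
    moreover have "(\<Union>j\<in>d i. I +> j) = d i"
      using ideal_incl_iff[OF I(1) primeideal.axioms(1)[OF P[OF that(1)]]] sub[OF that(1)] by blast
    ultimately show "r \<in> d i"
      by simp
  qed auto
  have "primeideal ((+>) I ` d i) (R Quot I)" if i: "i \<le> n" for i
  proof (rule primeidealI)
    interpret di: primeideal "d i" R by (rule P[OF i])
    show "ideal ((+>) I ` d i) (R Quot I)"
      by (rule ring_ideal_imp_quot_ideal[OF I(1) di.is_ideal])
    show "cring (R Quot I)"
      by (rule ideal.quotient_is_cring[OF I(1) is_cring])
    have "\<one> \<notin> d i"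
      using di.one_imp_carrier di.I_notcarr by auto
    then have "I +> \<one> \<notin> (+>) I ` d i"
      using mem[OF i] by simp
    then show "carrier (R Quot I) \<noteq> (+>) I ` d i"
      by (auto simp: FactRing_def A_RCOSETS_def')
    fix A B assume AB: "A \<in> carrier (R Quot I)" "B \<in> carrier (R Quot I)"
      "A \<otimes>\<^bsub>R Quot I\<^esub> B \<in> (+>) I ` d i"
    then obtain x y where xy: "x \<in> carrier R" "y \<in> carrier R" "A = I +> x" "B = I +> y"
      by (auto simp: FactRing_def A_RCOSETS_def')
    then have "A \<otimes>\<^bsub>R Quot I\<^esub> B = I +> (x \<otimes> y)"
      by (simp add: FactRing_def ideal.rcoset_mult_add[OF I(1)])
    then have "x \<otimes> y \<in> d i"
      using AB(3) mem[OF i] xy by simp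
    then show "A \<in> (+>) I ` d i \<or> B \<in> (+>) I ` d i"
      using di.I_prime xy by blast
  qed
  moreover have "(+>) I ` d i \<subset> (+>) I ` d (Suc i)" if i: "i < n" for i
  proof -
    have s: "d i \<subset> d (Suc i)"
      using d i by (auto simp: prime_chain_def)
    then obtain r where r: "r \<in> d (Suc i)" "r \<notin> d i" by blast
    moreover have "r \<in> carrier R"
      using r(1) ideal.Icarr[OF primeideal.axioms(1)[OF P[of "Suc i"]]] i by simp
    ultimately have "I +> r \<notin> (+>) I ` d i"
      using mem[of i r] i by simp
    then show ?thesis using s r by blast
  qed
  ultimately show ?thesis
    by (simp add: prime_chain_def)
qed

text \<open>Chains transfer in both directions with their lengths, so the dimension can be computed
  inside \<open>R\<close>, where the bound for polynomial rings applies.\<close>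

lemma (in cring) krull_dim_quotient:
  assumes "ideal I R"
  shows "krull_dim (R Quot I) = Sup {enat n | n. \<exists>d. prime_chain R n d \<and> I \<subseteq> d 0}"
  unfolding krull_dim_def
  by (rule arg_cong[where f = Sup])
     (use prime_chain_quotient quotient_prime_chain assms in blast)

section \<open>The ideal of order-preserving maps\<close>

lemma hom_var_eq: "hom_var p q = pvar (p, q)"
  by (simp add: hom_var_def pvar_def)

lemma graph_ideal_eq:
  "(graph_ideal \<psi> :: ('p::{finite,order}, 'q::{finite,order}, 'k::field) hom_poly set)
    = var_ideal (range (\<lambda>q. (\<psi> q, q)))"
proof -
  have "{hom_var (\<psi> q) q | q. True} = (pvar ` range (\<lambda>q. (\<psi> q, q)) :: ('p, 'q, 'k) hom_poly set)"
    by (auto simp: hom_var_eq)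
  then show ?thesis
    by (simp add: graph_ideal_def genideal_var)
qed

lemma card_graph: "card (range (\<lambda>q::'q::finite. (\<psi> q, q))) = CARD('q)"
  by (rule card_image) (auto intro: inj_onI)

lemma ideal_hom_ideal:
  "ideal (hom_ideal :: ('p::{finite,order}, 'q::{finite,order}, 'k::field) hom_poly set) hom_poly_ring"
  unfolding hom_ideal_def
  by (rule ring.genideal_ideal[OF ring_from_type_algebra]) (simp add: ring_of_type_algebra_def)

text \<open>A prime contains a product exactly when it contains one of the factors.\<close>

lemma hom_ideal_subset_iff:
  fixes \<pp> :: "('p::{finite,order}, 'q::{finite,order}, 'k::field) hom_poly set"
  assumes "primeideal \<pp> hom_poly_ring"
  shows "hom_ideal \<subseteq> \<pp> \<longleftrightarrow> (\<forall>\<phi>. mono \<phi> \<longrightarrow> (\<exists>p. pvar (p, \<phi> p) \<in> \<pp>))"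
proof -
  interpret ring "hom_poly_ring :: ('p, 'q, 'k) hom_poly ring"
    by (rule ring_from_type_algebra)
  have mem: "hom_monomial \<phi> \<in> \<pp> \<longleftrightarrow> (\<exists>p. pvar (p, \<phi> p) \<in> \<pp>)" for \<phi>
  proof
    assume "hom_monomial \<phi> \<in> \<pp>"
    then show "\<exists>p. pvar (p, \<phi> p) \<in> \<pp>"
      using type_prime_prod[OF assms, of UNIV "\<lambda>p. pvar (p, \<phi> p)"] by (auto simp: hom_monomial_def hom_var_eq)
  next
    assume "\<exists>p. pvar (p, \<phi> p) \<in> \<pp>"
    then obtain p where "pvar (p, \<phi> p) \<in> \<pp>" ..
    then show "hom_monomial \<phi> \<in> \<pp>"
      unfolding hom_monomial_def hom_var_eq
      by (rule type_prime_dvd[OF assms dvd_prodI, rotated 2]) auto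
  qed
  have "hom_ideal \<subseteq> \<pp> \<longleftrightarrow> {hom_monomial \<phi> | \<phi>. mono \<phi>} \<subseteq> \<pp>"
    unfolding hom_ideal_def
    by (rule Idl_subset_ideal[OF primeideal.axioms(1)[OF assms]])
       (simp add: ring_of_type_algebra_def)
  also have "\<dots> \<longleftrightarrow> (\<forall>\<phi>. mono \<phi> \<longrightarrow> hom_monomial \<phi> \<in> \<pp>)"
    by auto
  finally show ?thesis
    by (simp only: mem)
qed

text \<open>The constant map with value \<open>q\<close> is order-preserving, so some
  \<open>pvar (p, q)\<close> lies in the prime. Choosing such a \<open>p\<close> for each
  \<open>q\<close> defines \<open>\<psi>\<close>.\<close>

lemma graph_in_prime:
  fixes \<pp> :: "('p::{finite,order}, 'q::{finite,order}, 'k::field) hom_poly set"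
  assumes "primeideal \<pp> hom_poly_ring" "hom_ideal \<subseteq> \<pp>"
  obtains \<psi> where "graph_ideal \<psi> \<subseteq> \<pp>"
proof -
  have "\<exists>p. pvar (p, q) \<in> \<pp>" for q
    using assms(2) hom_ideal_subset_iff[OF assms(1)] by (auto dest!: spec[of _ "\<lambda>_. q"] intro: monoI)
  then obtain \<psi> where "\<And>q. pvar (\<psi> q, q) \<in> \<pp>" by metis
  then have "graph_ideal \<psi> \<subseteq> \<pp>"
    unfolding graph_ideal_eq
    by (intro var_ideal_minimal[OF primeideal.axioms(1)[OF assms(1)]]) auto
  then show thesis by (rule that)
qed

lemma graph_ideal_subset_imp_eq:
  assumes "(graph_ideal \<psi> :: ('p::{finite,order}, 'q::{finite,order}, 'k::field) hom_poly set)
    \<subseteq> graph_ideal \<psi>'"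
  shows "\<psi> = \<psi>'"
proof
  fix q
  have "(pvar (\<psi> q, q) :: ('p, 'q, 'k) hom_poly) \<in> graph_ideal \<psi>'"
    using assms by (rule subsetD) (simp add: graph_ideal_eq)
  then show "\<psi> q = \<psi>' q"
    by (auto simp: graph_ideal_eq)
qed

text \<open>Minimality is automatic once \<open>hom_ideal\<close> is contained: a prime in between
  contains some \<open>graph_ideal \<psi>'\<close>, and distinct graph ideals are never
  nested.\<close>

lemma graph_ideal_min_prime_iff:
  fixes \<psi> :: "'q::{finite,order} \<Rightarrow> 'p::{finite,order}"
  shows "graph_ideal \<psi> \<in> min_primes hom_poly_ring (hom_ideal :: ('p, 'q, 'k::field) hom_poly set)
    \<longleftrightarrow> (\<forall>\<phi>. mono \<phi> \<longrightarrow> (\<exists>p. (\<psi> \<circ> \<phi>) p = p))"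
proof -
  let ?g = "graph_ideal \<psi> :: ('p, 'q, 'k) hom_poly set"
  have P: "primeideal ?g hom_poly_ring"
    by (simp add: graph_ideal_eq primeideal_var_ideal)
  have minimal: "\<qq> = ?g" if \<qq>: "primeideal \<qq> hom_poly_ring" "hom_ideal \<subseteq> \<qq>" "\<qq> \<subseteq> ?g" for \<qq>
  proof -
    obtain \<psi>' where \<psi>': "graph_ideal \<psi>' \<subseteq> \<qq>"
      using \<qq>(1,2) by (rule graph_in_prime)
    then have "\<psi>' = \<psi>"
      using \<qq>(3) by (intro graph_ideal_subset_imp_eq[where 'k = 'k]) auto
    then show ?thesis using \<psi>' \<qq>(3) by blast
  qed
  have "?g \<in> min_primes hom_poly_ring hom_ideal \<longleftrightarrow> hom_ideal \<subseteq> ?g"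
    using P minimal by (auto simp: min_primes_def)
  \<comment> \<open>The pair \<open>(p, \<phi> p)\<close> is on the graph of \<open>\<psi>\<close>
    exactly when \<open>p\<close> is a fixed point of \<open>\<psi> \<circ> \<phi>\<close>.\<close>
  also have "\<dots> \<longleftrightarrow> (\<forall>\<phi>. mono \<phi> \<longrightarrow> (\<exists>p. (\<psi> \<circ> \<phi>) p = p))"
    unfolding hom_ideal_subset_iff[OF P] by (auto simp: graph_ideal_eq image_iff eq_commute)
  finally show ?thesis .
qed

section \<open>Heights of primes over the ideal and dimension of the quotient\<close>

lemma prime_height_graph_ideal:
  "prime_height hom_poly_ring
    (graph_ideal \<psi> :: ('p::{finite,order}, 'q::{finite,order}, 'k::field) hom_poly set)
    = enat CARD('q)"
  by (simp add: graph_ideal_eq prime_height_var_ideal card_graph)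

lemma prime_height_ge:
  fixes \<pp> :: "('p::{finite,order}, 'q::{finite,order}, 'k::field) hom_poly set"
  assumes "primeideal \<pp> hom_poly_ring" "hom_ideal \<subseteq> \<pp>"
  shows "enat CARD('q) \<le> prime_height hom_poly_ring \<pp>"
proof -
  obtain \<psi> where "graph_ideal \<psi> \<subseteq> \<pp>"
    using assms by (rule graph_in_prime)
  then show ?thesis
    using le_prime_height[OF assms(1)] card_graph[of \<psi>] by (metis graph_ideal_eq)
qed

text \<open>The composite with any \<open>\<phi>\<close> is constant with value \<open>p\<close>, so
  it fixes \<open>p\<close>. Such graph ideals witness that the least height and the dimension are
  attained.\<close>

lemma constant_graph_min_prime:
  "graph_ideal (\<lambda>_. p)
    \<in> min_primes hom_poly_ring (hom_ideal :: ('p::{finite,order}, 'q::{finite,order}, 'k::field) hom_poly set)"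
  unfolding graph_ideal_min_prime_iff by auto

text \<open>Adjoining the remaining variables to a constant graph ideal gives a chain of the
  required length. Conversely, a chain above the ideal starts above some graph ideal.\<close>

lemma krull_dim_hom_quotient_ring:
  "krull_dim (hom_quotient_ring :: ('p::{finite,order}, 'q::{finite,order}, 'k::field) hom_poly set ring)
    = enat (CARD('q) * (CARD('p) - 1))"
proof -
  let ?d = "CARD('q) * (CARD('p) - 1)"
  have codim: "card (UNIV - range (\<lambda>q. (\<psi> q, q))) = ?d" for \<psi> :: "'q \<Rightarrow> 'p"
    by (subst card_Diff_subset) (simp_all add: card_graph algebra_simps)
  have "krull_dim (hom_quotient_ring :: ('p, 'q, 'k) hom_poly set ring)
      = Sup {enat n | n. \<exists>c. prime_chain hom_poly_ring n c \<and> (hom_ideal :: ('p, 'q, 'k) hom_poly set) \<subseteq> c 0}"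
    unfolding hom_quotient_ring_def
    by (rule cring.krull_dim_quotient[OF cring_from_type_algebra ideal_hom_ideal])
  also have "\<dots> = enat ?d"
  proof (rule Sup_enat_eqI)
    obtain c where "prime_chain hom_poly_ring ?d c"
        "c 0 = (graph_ideal (\<lambda>_. undefined) :: ('p, 'q, 'k) hom_poly set)"
      using var_ideal_chain[of "range (\<lambda>q::'q. (undefined :: 'p, q))" UNIV]
      unfolding codim graph_ideal_eq by auto
    then show "\<exists>c. prime_chain hom_poly_ring ?d c \<and> (hom_ideal :: ('p, 'q, 'k) hom_poly set) \<subseteq> c 0"
      using constant_graph_min_prime by (auto simp: min_primes_def)
  next
    fix n assume "\<exists>c. prime_chain hom_poly_ring n c \<and> (hom_ideal :: ('p, 'q, 'k) hom_poly set) \<subseteq> c 0"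
    then obtain c where c: "prime_chain hom_poly_ring n c"
        "(hom_ideal :: ('p, 'q, 'k) hom_poly set) \<subseteq> c 0"
      by blast
    then obtain \<psi> where \<psi>: "graph_ideal \<psi> \<subseteq> c 0"
      using graph_in_prime[of "c 0"] by (auto simp: prime_chain_def)
    \<comment> \<open>Put in front of \<open>c\<close>, this chain uses up \<open>CARD('q)\<close>
      of the at most \<open>CARD('p \<times> 'q)\<close> available steps.\<close>
    obtain b where b: "prime_chain hom_poly_ring CARD('q) b"
        "b CARD('q) = (graph_ideal \<psi> :: ('p, 'q, 'k) hom_poly set)"
      using var_ideal_chain[of "{}" "range (\<lambda>q. (\<psi> q, q))"] by (auto simp: card_graph graph_ideal_eq)
    have "CARD('q) + n \<le> CARD('p \<times> 'q)"
      using prime_chain_append[OF b(1) c(1)] b(2) \<psi> by (intro prime_chain_length_le) auto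
    then have "n \<le> CARD('p) * CARD('q) - CARD('q)"
      by simp
    then show "n \<le> ?d"
      by (simp add: algebra_simps)
  qed
  finally show ?thesis .
qed

theorem corollary3p6:
  shows
    "(\<forall>\<pp> \<in> min_primes hom_poly_ring
         (hom_ideal :: ('p::{finite,order}, 'q::{finite,order}, 'k::field) hom_poly set).
       prime_height hom_poly_ring \<pp> \<ge> enat CARD('q))
     \<and> (\<exists>\<pp> \<in> min_primes hom_poly_ring (hom_ideal :: ('p, 'q, 'k) hom_poly set).
       prime_height hom_poly_ring \<pp> = enat CARD('q))
     \<and> (\<forall>\<psi> :: 'q \<Rightarrow> 'p. mono \<psi> \<longrightarrow>
       (graph_ideal \<psi> \<in> min_primes hom_poly_ring (hom_ideal :: ('p, 'q, 'k) hom_poly set)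
        \<longleftrightarrow> (\<forall>\<phi> :: 'p \<Rightarrow> 'q. mono \<phi> \<longrightarrow> (\<exists>p. (\<psi> \<circ> \<phi>) p = p))))
     \<and> ideal_height hom_poly_ring (hom_ideal :: ('p, 'q, 'k) hom_poly set) = enat CARD('q)
     \<and> krull_dim (hom_quotient_ring :: ('p, 'q, 'k) hom_poly set ring)
       = enat (CARD('q) * (CARD('p) - 1))"
proof (intro conjI)
  show "\<forall>\<pp> \<in> min_primes hom_poly_ring (hom_ideal :: ('p, 'q, 'k) hom_poly set).
      enat CARD('q) \<le> prime_height hom_poly_ring \<pp>"
    by (auto simp: min_primes_def intro: prime_height_ge)
  show "\<exists>\<pp> \<in> min_primes hom_poly_ring (hom_ideal :: ('p, 'q, 'k) hom_poly set).
      prime_height hom_poly_ring \<pp> = enat CARD('q)"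
    using constant_graph_min_prime prime_height_graph_ideal by blast
  show "\<forall>\<psi> :: 'q \<Rightarrow> 'p. mono \<psi> \<longrightarrow>
       (graph_ideal \<psi> \<in> min_primes hom_poly_ring (hom_ideal :: ('p, 'q, 'k) hom_poly set)
        \<longleftrightarrow> (\<forall>\<phi> :: 'p \<Rightarrow> 'q. mono \<phi> \<longrightarrow> (\<exists>p. (\<psi> \<circ> \<phi>) p = p)))"
    by (simp only: graph_ideal_min_prime_iff simp_thms)
  show "ideal_height hom_poly_ring (hom_ideal :: ('p, 'q, 'k) hom_poly set) = enat CARD('q)"
    unfolding ideal_height_def
  proof (rule antisym)
    have "graph_ideal (\<lambda>_. undefined) \<in> min_primes hom_poly_ring (hom_ideal :: ('p, 'q, 'k) hom_poly set)"
      by (rule constant_graph_min_prime)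
    then show "Inf {prime_height hom_poly_ring \<pp> | \<pp>. primeideal \<pp> hom_poly_ring \<and>
        (hom_ideal :: ('p, 'q, 'k) hom_poly set) \<subseteq> \<pp>} \<le> enat CARD('q)"
      by (intro Inf_lower CollectI exI[of _ "graph_ideal (\<lambda>_. undefined)"])
         (simp add: min_primes_def prime_height_graph_ideal)
  \<comment> \<open>The infimum runs over all primes above the ideal, so the lower bound is applied
    to each of them and not merely to the minimal ones.\<close>
  qed (auto intro!: Inf_greatest prime_height_ge)
qed (rule krull_dim_hom_quotient_ring)

end
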